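(* For any finite simple graph $G$ with $q$ orbits, the multiplicity of zero as a root of the polynomial $\mathfrak{D}_k(G)$ (in the variable $k$) is at least $q$.
   Context: A $k$-coloring of $G$ is any map $c:V(G)\to\{1,\dots,k\}$; it is distinguishing if the only automorphism $f$ of $G$ with $c(f(v))=c(v)$ for all $v\in V(G)$ is the identity. The number $\mathfrak{D}_k(G)$ of distinguishing maps $c:V(G)\to\{1,\dots,k\}$ is a monic polynomial in $k$ of degree $|V(G)|$, called the distinguishing polynomial of $G$. An orbit of $G$ is an orbit of the action of $\mathrm{Aut}(G)$ on $V(G)$, i.e. a maximal subset $\mathcal{O}$ of $V(G)$ such that for all $x,y\in\mathcal{O}$ there exists $f\in\mathrm{Aut}(G)$ with $f(x)=y$. *)

theory Defs
  imports
    "HOL-Computational_Algebra.Polynomial"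
    "HOL-Combinatorics.Permutations"
    "HOL-Library.FuncSet"
begin

definition finite_simple_graph :: "'a set \<Rightarrow> 'a set set \<Rightarrow> bool" where
  "finite_simple_graph V E \<longleftrightarrow> finite V \<and> (\<forall>e\<in>E. e \<subseteq> V \<and> card e = 2)"

(* An automorphism is a bijection of V; "permutes" additionally makes it the identity
   outside V, so that distinct functions are distinct automorphisms and "id" is the
   identity automorphism. *)
definition graph_automorphisms :: "'a set \<Rightarrow> 'a set set \<Rightarrow> ('a \<Rightarrow> 'a) set" where
  "graph_automorphisms V E =
     {f. f permutes V \<and> (\<forall>x\<in>V. \<forall>y\<in>V. {x, y} \<in> E \<longleftrightarrow> {f x, f y} \<in> E)}"

definition graph_orbits :: "'a set \<Rightarrow> 'a set set \<Rightarrow> 'a set set" where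
  "graph_orbits V E = (\<lambda>x. {f x |f. f \<in> graph_automorphisms V E}) ` V"

definition distinguishing :: "'a set \<Rightarrow> 'a set set \<Rightarrow> ('a \<Rightarrow> 'c) \<Rightarrow> bool" where
  "distinguishing V E c \<longleftrightarrow>
     (\<forall>f\<in>graph_automorphisms V E. (\<forall>v\<in>V. c (f v) = c v) \<longrightarrow> f = id)"

(* Colourings are extensional functions on V (undefined outside V), so each map
   V \<rightarrow> {1..k} is counted once. *)
definition distinguishing_count :: "'a set \<Rightarrow> 'a set set \<Rightarrow> nat \<Rightarrow> nat" where
  "distinguishing_count V E k = card {c \<in> V \<rightarrow>\<^sub>E {1..k}. distinguishing V E c}"

(* Existence and uniqueness of this polynomial for finite simple graphs are proved below. *)
definition distinguishing_poly :: "'a set \<Rightarrow> 'a set set \<Rightarrow> int poly" where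
  "distinguishing_poly V E =
     (THE p. \<forall>k::nat. poly p (int k) = int (distinguishing_count V E k))"

lemma poly_eq_if_eq_on_nat:
  fixes p q :: "int poly"
  assumes "\<And>k::nat. poly p (int k) = poly q (int k)"
  shows "p = q"
proof (rule ccontr)
  assume "p \<noteq> q"
  then have "finite {x. poly (p - q) x = 0}"
    by (intro poly_roots_finite) auto
  moreover have "range int \<subseteq> {x. poly (p - q) x = 0}"
    using assms by auto
  ultimately have "finite (range int)"
    by (rule rev_finite_subset)
  then show False
    by (simp add: finite_image_iff)
qed

(* Colourings of V constant along a relation r are counted by a polynomial, of degree
   |V| exactly when r forces no identification of distinct vertices. *)
lemma constrained_colourings_poly:
  assumes "finite V" "r \<subseteq> V \<times> V"
  shows "\<exists>m\<le>card V. (m = card V \<longleftrightarrow> r \<subseteq> Id) \<and>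
    (\<forall>k::nat. card {c \<in> V \<rightarrow>\<^sub>E {1..k}. \<forall>(x, y)\<in>r. c x = c y} = k ^ m)"
  using assms
proof (induction "card V" arbitrary: V r rule: less_induct)
  case less
  show ?case
  proof (cases "r \<subseteq> Id")
    case True
    then have "{c \<in> V \<rightarrow>\<^sub>E {1..k}. \<forall>(x, y)\<in>r. c x = c y} = V \<rightarrow>\<^sub>E {1..k}" for k :: nat
      by auto
    then show ?thesis
      using True less.prems by (intro exI[of _ "card V"]) (simp add: card_funcsetE)
  next
    case False
    then obtain a b where ab: "(a, b) \<in> r" "a \<noteq> b" by auto
    then have abV: "a \<in> V" "b \<in> V" using less.prems by auto
    let ?W = "V - {a}"
    let ?g = "\<lambda>x. if x = a then b else x"
    let ?r = "map_prod ?g ?g ` r"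
    have lt: "card ?W < card V"
      using abV less.prems by (intro psubset_card_mono) auto
    have "?r \<subseteq> ?W \<times> ?W"
      using ab abV less.prems by (auto split: if_splits)
    then obtain m where m: "m \<le> card ?W"
      "\<And>k::nat. card {c \<in> ?W \<rightarrow>\<^sub>E {1..k}. \<forall>(x, y)\<in>?r. c x = c y} = k ^ m"
      using less.hyps[OF lt, of ?r] less.prems by auto
    have "card {c \<in> V \<rightarrow>\<^sub>E {1..k}. \<forall>(x, y)\<in>r. c x = c y} = k ^ m" for k :: nat
    proof -
      let ?A = "{c \<in> V \<rightarrow>\<^sub>E {1..k}. \<forall>(x, y)\<in>r. c x = c y}"
      let ?B = "{c \<in> ?W \<rightarrow>\<^sub>E {1..k}. \<forall>(x, y)\<in>?r. c x = c y}"
      have "bij_betw (\<lambda>c. restrict c ?W) ?A ?B"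
      proof (rule bij_betw_byWitness[where f' = "\<lambda>c. c(a := c b)"])
        show "\<forall>c\<in>?A. (restrict c ?W)(a := restrict c ?W b) = c"
          using ab abV by (fastforce simp: fun_eq_iff restrict_def PiE_def extensional_def)
        show "\<forall>c\<in>?B. restrict (c(a := c b)) ?W = c"
          by (auto simp: fun_eq_iff restrict_def PiE_def extensional_def)
        show "(\<lambda>c. restrict c ?W) ` ?A \<subseteq> ?B"
        proof (intro image_subsetI)
          fix c assume c: "c \<in> ?A"
          then have "c (?g x) = c x" for x
            using ab by auto
          moreover have "?g x \<in> ?W" if "x \<in> V" for x
            using that ab abV by auto
          ultimately have "restrict c ?W (?g x) = c x" if "x \<in> V" for x
            using that by (simp only: restrict_apply')
          then have "restrict c ?W (?g x) = restrict c ?W (?g y)" if "(x, y) \<in> r" for x y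
          proof -
            have "x \<in> V" "y \<in> V" "c x = c y"
              using that c less.prems by auto
            with \<open>\<And>x. x \<in> V \<Longrightarrow> restrict c ?W (?g x) = c x\<close> show ?thesis
              by metis
          qed
          moreover have "restrict c ?W \<in> ?W \<rightarrow>\<^sub>E {1..k}"
            using c by auto
          ultimately show "restrict c ?W \<in> ?B"
            by (auto simp del: restrict_apply)
        qed
        show "(\<lambda>c. c(a := c b)) ` ?B \<subseteq> ?A"
        proof (intro image_subsetI)
          fix c assume c: "c \<in> ?B"
          have "(c(a := c b)) x = c (?g x)" for x by auto
          moreover have "c (?g x) = c (?g y)" if "(x, y) \<in> r" for x y
            using c that by fastforce
          moreover have "c(a := c b) \<in> V \<rightarrow>\<^sub>E {1..k}"
            using c ab abV by (auto simp: PiE_def extensional_def Pi_def)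
          ultimately show "c(a := c b) \<in> ?A"
            by (auto simp del: fun_upd_apply)
        qed
      qed
      from bij_betw_same_card[OF this] m(2)[of k] show ?thesis
        by (rule trans)
    qed
    then show ?thesis
      using False m(1) lt by (intro exI[of _ m]) auto
  qed
qed

lemma avoiding_colourings_poly:
  assumes "finite V" "finite A" "r \<subseteq> V \<times> V" "\<And>s. s \<in> A \<Longrightarrow> s \<subseteq> V \<times> V \<and> \<not> s \<subseteq> Id"
  shows "\<exists>p::int poly. degree p \<le> card V \<and> coeff p (card V) = (if r \<subseteq> Id then 1 else 0) \<and>
    (\<forall>k::nat. poly p (int k) = int (card {c \<in> V \<rightarrow>\<^sub>E {1..k}.
       (\<forall>(x, y)\<in>r. c x = c y) \<and> (\<forall>s\<in>A. \<not> (\<forall>(x, y)\<in>s. c x = c y))}))"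
  using assms(2,3,4)
proof (induction A arbitrary: r rule: finite_induct)
  case empty
  obtain m where "m \<le> card V" "m = card V \<longleftrightarrow> r \<subseteq> Id"
    "\<And>k::nat. card {c \<in> V \<rightarrow>\<^sub>E {1..k}. \<forall>(x, y)\<in>r. c x = c y} = k ^ m"
    using constrained_colourings_poly[OF assms(1) empty(1)] by blast
  then show ?case
    by (intro exI[of _ "monom 1 m"]) (auto simp: degree_monom_eq poly_monom)
next
  case (insert s A)
  let ?N = "\<lambda>r A k. {c \<in> V \<rightarrow>\<^sub>E {1..k::nat}.
    (\<forall>(x, y)\<in>r. c x = c y) \<and> (\<forall>s\<in>A. \<not> (\<forall>(x, y)\<in>s. c x = c y))}"
  obtain p :: "int poly" where p: "degree p \<le> card V"
    "coeff p (card V) = (if r \<subseteq> Id then 1 else 0)"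
    "\<And>k. poly p (int k) = int (card (?N r A k))"
    using insert.IH[of r] insert.prems by auto
  have "r \<union> s \<subseteq> V \<times> V" "\<not> r \<union> s \<subseteq> Id"
    using insert.prems by auto
  then obtain q :: "int poly" where q: "degree q \<le> card V" "coeff q (card V) = 0"
    "\<And>k. poly q (int k) = int (card (?N (r \<union> s) A k))"
  proof -
    assume *: "\<And>q::int poly. degree q \<le> card V \<Longrightarrow> coeff q (card V) = 0 \<Longrightarrow>
      (\<And>k. poly q (int k) = int (card (?N (r \<union> s) A k))) \<Longrightarrow> thesis"
    have "\<exists>q::int poly. degree q \<le> card V \<and> coeff q (card V) = (if r \<union> s \<subseteq> Id then 1 else 0) \<and>
      (\<forall>k. poly q (int k) = int (card (?N (r \<union> s) A k)))"
      using \<open>r \<union> s \<subseteq> V \<times> V\<close> insert.prems(2) by (intro insert.IH) blast+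
    then show thesis
      unfolding if_not_P[OF \<open>\<not> r \<union> s \<subseteq> Id\<close>] by (elim exE conjE) (rule *, assumption+, erule spec)
  qed
  have "poly (p - q) (int k) = int (card (?N r (insert s A) k))" for k
  proof -
    have fin: "finite (?N r' A' k)" for r' A'
      by (rule finite_subset[of _ "V \<rightarrow>\<^sub>E {1..k}"]) (auto intro!: finite_PiE assms(1))
    have "?N r A k = ?N r (insert s A) k \<union> ?N (r \<union> s) A k"
      by auto
    moreover have "?N r (insert s A) k \<inter> ?N (r \<union> s) A k = {}"
      by auto
    ultimately have "card (?N r A k) = card (?N r (insert s A) k) + card (?N (r \<union> s) A k)"
      using card_Un_disjoint[OF fin[of r "insert s A"] fin[of "r \<union> s" A]] by simp
    then show ?thesis
      using p(3) q(3) by simp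
  qed
  then show ?case
    using p(1,2) q(1,2) by (intro exI[of _ "p - q"]) (auto intro: degree_diff_le)
qed

lemma distinguishing_poly_exists:
  assumes "finite_simple_graph V E"
  shows "\<exists>p::int poly. degree p = card V \<and> lead_coeff p = 1 \<and>
    (\<forall>k::nat. poly p (int k) = int (distinguishing_count V E k))"
proof -
  have V: "finite V" using assms by (simp add: finite_simple_graph_def)
  let ?gr = "\<lambda>f. (\<lambda>v. (f v, v)) ` V"
  let ?F = "graph_automorphisms V E - {id}"
  have "finite ?F"
    by (rule finite_subset[OF _ finite_permutations[OF V]]) (auto simp: graph_automorphisms_def)
  moreover have "?gr f \<subseteq> V \<times> V \<and> \<not> ?gr f \<subseteq> Id" if "f \<in> ?F" for f
  proof -
    have f: "f permutes V" "f \<noteq> id" using that by (auto simp: graph_automorphisms_def)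
    then obtain v where v: "f v \<noteq> v" by (auto simp: fun_eq_iff)
    with f have "v \<in> V" by (meson permutes_not_in)
    then have "(f v, v) \<in> ?gr f" by (rule imageI)
    with v f show ?thesis by (auto simp: permutes_in_image)
  qed
  ultimately obtain p :: "int poly" where p: "degree p \<le> card V" "coeff p (card V) = 1"
    "\<And>k::nat. poly p (int k) = int (card {c \<in> V \<rightarrow>\<^sub>E {1..k}.
       (\<forall>(x, y)\<in>{}. c x = c y) \<and> (\<forall>s\<in>?gr ` ?F. \<not> (\<forall>(x, y)\<in>s. c x = c y))})"
    using avoiding_colourings_poly[OF V, of "?gr ` ?F" "{}"] by auto
  have "degree p = card V"
    using p(1,2) le_degree[of p "card V"] by simp
  moreover have "distinguishing V E c \<longleftrightarrow>
      (\<forall>(x, y)\<in>{}. c x = c y) \<and> (\<forall>s\<in>?gr ` ?F. \<not> (\<forall>(x, y)\<in>s. c x = c y))"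
    for c :: "'a \<Rightarrow> nat"
    by (auto simp: distinguishing_def)
  ultimately show ?thesis
    using p(2,3) by (auto simp: distinguishing_count_def)
qed

lemma poly_distinguishing_poly:
  assumes "finite_simple_graph V E"
  shows "poly (distinguishing_poly V E) (int k) = int (distinguishing_count V E k)"
proof -
  have "\<exists>!p::int poly. \<forall>k::nat. poly p (int k) = int (distinguishing_count V E k)"
    using distinguishing_poly_exists[OF assms] by (metis poly_eq_if_eq_on_nat)
  from theI'[OF this] show ?thesis
    by (simp add: distinguishing_poly_def)
qed

lemma distinguishing_poly_monic:
  assumes "finite_simple_graph V E"
  shows "degree (distinguishing_poly V E) = card V"
    and "lead_coeff (distinguishing_poly V E) = 1"
proof -
  obtain p :: "int poly" where "degree p = card V" "lead_coeff p = 1"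
    "\<And>k::nat. poly p (int k) = int (distinguishing_count V E k)"
    using distinguishing_poly_exists[OF assms] by auto
  moreover from this have "distinguishing_poly V E = p"
    by (intro poly_eq_if_eq_on_nat) (simp add: poly_distinguishing_poly[OF assms])
  ultimately show "degree (distinguishing_poly V E) = card V"
    and "lead_coeff (distinguishing_poly V E) = 1"
    by auto
qed

end

theory Submission
  imports Defs
begin

text \<open>
  By inclusion-exclusion over the nontrivial automorphisms, the distinguishing polynomial is an
  integer combination of the monomials counting the colourings preserved by every element of a
  set of automorphisms. Every map that is constant on the orbits of the graph is such a
  colouring, so each of these monomials has degree at least \<open>q\<close>.
\<close>

text \<open>Pulling back along \<open>h\<close> turns colourings of the image of \<open>V\<close>
  under \<open>h\<close> into colourings of \<open>V\<close> constant along \<open>r\<close>.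
  Distinct colourings have distinct pullbacks, so comparing the two counts bounds the exponent
  \<open>m\<close>.\<close>

lemma card_le_constrained_exponent:
  fixes h :: "'a \<Rightarrow> 'b"
  assumes "finite V" "r \<subseteq> V \<times> V" "\<forall>(x, y)\<in>r. h x = h y"
    and m: "\<And>k::nat. card {c \<in> V \<rightarrow>\<^sub>E {1..k}. \<forall>(x, y)\<in>r. c x = c y} = k ^ m"
  shows "card (h ` V) \<le> m"
proof -
  \<comment> \<open>Two colours are enough: base 2 is the least for which an inequality of powers
    gives one of exponents.\<close>
  let ?A = "h ` V \<rightarrow>\<^sub>E {1..2::nat}"
  let ?B = "{c \<in> V \<rightarrow>\<^sub>E {1..2::nat}. \<forall>(x, y)\<in>r. c x = c y}"
  let ?pull = "\<lambda>d. restrict (d \<circ> h) V"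
  have "inj_on ?pull ?A"
  proof (rule inj_onI)
    fix d e assume d: "d \<in> ?A" and e: "e \<in> ?A" and eq: "?pull d = ?pull e"
    have "d (h x) = e (h x)" if "x \<in> V" for x
      using fun_cong[OF eq, of x] that by simp
    with d e show "d = e"
      by (intro PiE_ext) auto
  qed
  moreover have "?pull ` ?A \<subseteq> ?B"
  proof (intro image_subsetI)
    fix d assume d: "d \<in> ?A"
    have "?pull d x = ?pull d y" if "(x, y) \<in> r" for x y
      using that assms(2,3) by auto
    moreover have "?pull d \<in> V \<rightarrow>\<^sub>E {1..2}"
      using d by auto
    ultimately show "?pull d \<in> ?B"
      by (auto simp del: restrict_apply)
  qed
  moreover have "finite ?B"
    by (rule finite_subset[of _ "V \<rightarrow>\<^sub>E {1..2}"]) (auto intro!: finite_PiE assms(1))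
  ultimately have "card ?A \<le> card ?B"
    by (rule card_inj_on_le)
  then have "(2::nat) ^ card (h ` V) \<le> 2 ^ m"
    unfolding m using assms(1) by (simp add: card_funcsetE)
  then show ?thesis
    by simp
qed

text \<open>Inclusion-exclusion by induction on \<open>A\<close>. The relation \<open>r\<close>
  stays arbitrary because the subtracted term imposes \<open>s\<close> as a further constraint. As
  \<open>h\<close> is constant along every relation involved, each monomial that arises is divisible
  by the required power, and divisibility survives subtraction.\<close>

lemma avoiding_colourings_poly_dvd:
  fixes h :: "'a \<Rightarrow> 'b"
  assumes "finite V" "finite A" "r \<subseteq> V \<times> V" "\<forall>(x, y)\<in>r. h x = h y"
    and "\<And>s. s \<in> A \<Longrightarrow> s \<subseteq> V \<times> V \<and> (\<forall>(x, y)\<in>s. h x = h y)"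
  shows "\<exists>p::int poly. [:0, 1:] ^ card (h ` V) dvd p \<and>
    (\<forall>k::nat. poly p (int k) = int (card {c \<in> V \<rightarrow>\<^sub>E {1..k}.
       (\<forall>(x, y)\<in>r. c x = c y) \<and> (\<forall>s\<in>A. \<not> (\<forall>(x, y)\<in>s. c x = c y))}))"
  using assms(2-)
proof (induction A arbitrary: r rule: finite_induct)
  case empty
  obtain m where m: "\<And>k::nat. card {c \<in> V \<rightarrow>\<^sub>E {1..k}. \<forall>(x, y)\<in>r. c x = c y} = k ^ m"
    using constrained_colourings_poly[OF assms(1) empty(1)] by blast
  have "card (h ` V) \<le> m"
    using card_le_constrained_exponent[OF assms(1) empty(1,2) m] .
  with m show ?case
    by (intro exI[of _ "[:0, 1:] ^ m"]) (simp add: le_imp_power_dvd)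
next
  case (insert s A)
  let ?N = "\<lambda>r A k. {c \<in> V \<rightarrow>\<^sub>E {1..k::nat}.
    (\<forall>(x, y)\<in>r. c x = c y) \<and> (\<forall>s\<in>A. \<not> (\<forall>(x, y)\<in>s. c x = c y))}"
  have A: "t \<subseteq> V \<times> V \<and> (\<forall>(x, y)\<in>t. h x = h y)" if "t \<in> A" for t
    by (rule insert.prems(3)) (rule insertI2[OF that])
  have IH: "\<exists>p::int poly. [:0, 1:] ^ card (h ` V) dvd p \<and>
      (\<forall>k. poly p (int k) = int (card (?N r' A k)))"
    if "r' \<subseteq> V \<times> V" "\<forall>(x, y)\<in>r'. h x = h y" for r'
    by (rule insert.IH[OF that A])
  have rs: "r \<union> s \<subseteq> V \<times> V" "\<forall>(x, y)\<in>r \<union> s. h x = h y"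
    using insert.prems(1,2) insert.prems(3)[OF insertI1] by (blast, blast)
  obtain p :: "int poly" where p: "[:0, 1:] ^ card (h ` V) dvd p"
    "\<And>k. poly p (int k) = int (card (?N r A k))"
    using IH[OF insert.prems(1,2)] by (elim exE conjE) (rule that, assumption, erule spec)
  obtain q :: "int poly" where q: "[:0, 1:] ^ card (h ` V) dvd q"
    "\<And>k. poly q (int k) = int (card (?N (r \<union> s) A k))"
    using IH[OF rs] by (elim exE conjE) (rule that, assumption, erule spec)
  have "poly (p - q) (int k) = int (card (?N r (insert s A) k))" for k
  proof -
    have fin: "finite (?N r' A' k)" for r' A'
      by (rule finite_subset[of _ "V \<rightarrow>\<^sub>E {1..k}"]) (auto intro!: finite_PiE assms(1))
    \<comment> \<open>Colourings that violate every member of \<open>A\<close> are split by whether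
      they also violate \<open>s\<close>; those that do not are constant along
      \<open>r \<union> s\<close>.\<close>
    have "?N r A k = ?N r (insert s A) k \<union> ?N (r \<union> s) A k"
      by auto
    moreover have "?N r (insert s A) k \<inter> ?N (r \<union> s) A k = {}"
      by auto
    ultimately have "card (?N r A k) = card (?N r (insert s A) k) + card (?N (r \<union> s) A k)"
      using card_Un_disjoint[OF fin[of r "insert s A"] fin[of "r \<union> s" A]] by simp
    then show ?thesis
      using p(2) q(2) by simp
  qed
  with dvd_diff[OF p(1) q(1)] show ?case
    by (intro exI[of _ "p - q"] conjI allI)
qed

lemma graph_automorphisms_comp:
  assumes "f \<in> graph_automorphisms V E" "g \<in> graph_automorphisms V E"
  shows "g \<circ> f \<in> graph_automorphisms V E"
proof -
  have f: "f permutes V" "\<And>x y. x \<in> V \<Longrightarrow> y \<in> V \<Longrightarrow> {x, y} \<in> E \<longleftrightarrow> {f x, f y} \<in> E"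
    and g: "g permutes V" "\<And>x y. x \<in> V \<Longrightarrow> y \<in> V \<Longrightarrow> {x, y} \<in> E \<longleftrightarrow> {g x, g y} \<in> E"
    using assms by (auto simp: graph_automorphisms_def)
  have "{x, y} \<in> E \<longleftrightarrow> {(g \<circ> f) x, (g \<circ> f) y} \<in> E" if "x \<in> V" "y \<in> V" for x y
    using f(2)[OF that] g(2)[of "f x" "f y"] that by (simp add: permutes_in_image[OF f(1)])
  with permutes_compose[OF f(1) g(1)] show ?thesis
    by (simp add: graph_automorphisms_def)
qed

lemma graph_automorphisms_inv:
  assumes "f \<in> graph_automorphisms V E"
  shows "inv f \<in> graph_automorphisms V E"
proof -
  have f: "f permutes V" "\<And>x y. x \<in> V \<Longrightarrow> y \<in> V \<Longrightarrow> {x, y} \<in> E \<longleftrightarrow> {f x, f y} \<in> E"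
    using assms by (auto simp: graph_automorphisms_def)
  have "{x, y} \<in> E \<longleftrightarrow> {inv f x, inv f y} \<in> E" if "x \<in> V" "y \<in> V" for x y
    using that f(2)[of "inv f x" "inv f y"] permutes_inverses(1)[OF f(1)]
      permutes_in_image[OF permutes_inv[OF f(1)]] by simp
  with permutes_inv[OF f(1)] show ?thesis
    by (simp add: graph_automorphisms_def)
qed

text \<open>The substitution of \<open>g \<circ> f\<close> for \<open>g\<close> permutes the
  automorphism group, with \<open>g \<circ> inv f\<close> as its inverse. This makes the map from
  vertices to orbits constant along the pairs \<open>(f v, v)\<close>.\<close>

lemma graph_orbit_image_eq:
  assumes "f \<in> graph_automorphisms V E"
  shows "{g (f v) |g. g \<in> graph_automorphisms V E} = {g v |g. g \<in> graph_automorphisms V E}"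
proof (intro equalityI subsetI)
  fix w assume "w \<in> {g (f v) |g. g \<in> graph_automorphisms V E}"
  then obtain g where "g \<in> graph_automorphisms V E" "w = (g \<circ> f) v"
    by auto
  with graph_automorphisms_comp[OF assms] show "w \<in> {g v |g. g \<in> graph_automorphisms V E}"
    by blast
next
  fix w assume "w \<in> {g v |g. g \<in> graph_automorphisms V E}"
  then obtain g where g: "g \<in> graph_automorphisms V E" "w = g v"
    by auto
  have "f permutes V"
    using assms by (simp add: graph_automorphisms_def)
  then have "w = (g \<circ> inv f) (f v)"
    by (simp add: g(2) permutes_inverses(2))
  with graph_automorphisms_comp[OF graph_automorphisms_inv[OF assms] g(1)]
  show "w \<in> {g (f v) |g. g \<in> graph_automorphisms V E}"
    by blast
qed

theorem theorem4p3:
  fixes V :: "'a set" and E :: "'a set set" and q :: nat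
  assumes "finite_simple_graph V E"
    and "card (graph_orbits V E) = q"
  shows "order 0 (distinguishing_poly V E) \<ge> q"
proof -
  have V: "finite V"
    using assms(1) by (simp add: finite_simple_graph_def)
  \<comment> \<open>A colouring is preserved by \<open>f\<close> exactly when it is constant along
    the pairs \<open>(f v, v)\<close>. Distinguishing colourings are thus those that violate the
    relation of every nontrivial automorphism.\<close>
  let ?gr = "\<lambda>f. (\<lambda>v. (f v, v)) ` V"
  let ?F = "graph_automorphisms V E - {id}"
  \<comment> \<open>Sending each vertex to its orbit makes the image of \<open>V\<close> the set of
    orbits, which has \<open>q\<close> elements.\<close>
  define h where "h x = {f x |f. f \<in> graph_automorphisms V E}" for x
  have "finite ?F"
    by (rule finite_subset[OF _ finite_permutations[OF V]]) (auto simp: graph_automorphisms_def)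
  then have finite: "finite (?gr ` ?F)"
    by (rule finite_imageI)
  have orbits: "s \<subseteq> V \<times> V \<and> (\<forall>(x, y)\<in>s. h x = h y)" if s: "s \<in> ?gr ` ?F" for s
  proof -
    obtain f where f: "f \<in> graph_automorphisms V E" "s = ?gr f"
      using s by auto
    then have "s \<subseteq> V \<times> V"
      by (auto simp: graph_automorphisms_def permutes_in_image)
    moreover have "\<forall>(x, y)\<in>s. h x = h y"
      unfolding f(2) h_def using graph_orbit_image_eq[OF f(1)] by simp
    ultimately show ?thesis ..
  qed
  \<comment> \<open>The constraint \<open>r\<close> starts out empty; only the avoidance conditions
    are imposed.\<close>
  have "\<exists>p::int poly. [:0, 1:] ^ card (h ` V) dvd p \<and>
    (\<forall>k::nat. poly p (int k) = int (card {c \<in> V \<rightarrow>\<^sub>E {1..k}.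
       (\<forall>(x, y)\<in>{}. c x = c y) \<and> (\<forall>s\<in>?gr ` ?F. \<not> (\<forall>(x, y)\<in>s. c x = c y))}))"
    by (rule avoiding_colourings_poly_dvd[OF V finite _ _ orbits]) auto
  then obtain p :: "int poly" where p: "[:0, 1:] ^ card (h ` V) dvd p"
    "\<And>k::nat. poly p (int k) = int (card {c \<in> V \<rightarrow>\<^sub>E {1..k}.
       (\<forall>(x, y)\<in>{}. c x = c y) \<and> (\<forall>s\<in>?gr ` ?F. \<not> (\<forall>(x, y)\<in>s. c x = c y))})"
    by blast
  have "distinguishing V E c \<longleftrightarrow>
      (\<forall>(x, y)\<in>{}. c x = c y) \<and> (\<forall>s\<in>?gr ` ?F. \<not> (\<forall>(x, y)\<in>s. c x = c y))"
    for c :: "'a \<Rightarrow> nat"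
    by (auto simp: distinguishing_def)
  then have "distinguishing_poly V E = p"
    using p(2) by (intro poly_eq_if_eq_on_nat)
      (simp add: poly_distinguishing_poly[OF assms(1)] distinguishing_count_def)
  moreover have "card (h ` V) = q"
    using assms(2) by (simp add: graph_orbits_def h_def)
  ultimately have "[:- 0, 1:] ^ q dvd distinguishing_poly V E"
    using p(1) by simp
  \<comment> \<open>Every power divides the zero polynomial, so divisibility bounds the order of the
    root only once this case is excluded; being monic excludes it.\<close>
  moreover have "distinguishing_poly V E \<noteq> 0"
    using distinguishing_poly_monic(2)[OF assms(1)] by auto
  ultimately show ?thesis
    unfolding order_divides by blast
qed

end
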